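(* Let $q\in[0,1]$. The linear map $T_q$ determined by $T_qz^n=\frac{z^n}{[n]_q!}$, $n=0,1,2,\ldots$, is an isometry from $\mathbf H_2$ onto $\mathcal F_{2,q}$.
   Context: For $q\in[0,1]$ put $[n]_q=1+q+\cdots+q^{n-1}$ for $n\ge1$, $[0]_q!=1$ and $[n]_q!=[1]_q[2]_q\cdots[n]_q$. $\mathbf H_2$ is the Hardy space of the open unit disk (power series $\sum a_nz^n$ with $\sum|a_n|^2<\infty$ and inner product $\sum a_n\overline{b_n}$). $\mathcal F_{2,q}$ is the Hilbert space of power series $f(z)=\sum_{n\ge 0} f_nz^n$ with $\sum_{n\ge 0}|f_n|^2([n]_q!)^2<\infty$ and inner product $\langle f,g\rangle=\sum_{n\ge 0} f_n\overline{g_n}([n]_q!)^2$; its reproducing kernel is $\sum_{n\ge 0}\frac{z^n\overline w^n}{([n]_q!)^2}$. The operator $T_q$ acts by $T_q\left(\sum a_nz^n\right)=\sum \frac{a_n}{[n]_q!}z^n$. *)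

theory Defs
  imports "HOL-Analysis.Analysis"
begin

definition q_int :: "real \<Rightarrow> nat \<Rightarrow> real" where
  "q_int q n = (\<Sum>k<n. q ^ k)"  (* since 0 ^ 0 = 1, q_int 0 n = 1 for n > 0 *)

definition q_fact :: "real \<Rightarrow> nat \<Rightarrow> real" where
  "q_fact q n = (\<Prod>k=1..n. q_int q k)"

text \<open>
  Elements of the two spaces are represented by their power series, of type
  \<^typ>\<open>complex fps\<close>; the monomial $z^n$ is \<^term>\<open>fps_X ^ n :: complex fps\<close> and the scalar multiple
  $c f$ is \<^term>\<open>fps_const c * f\<close>.  By \<open>conv_radius_H2\<close> and \<open>conv_radius_F2q\<close> below every such
  series converges at least in the open unit disk, so it is determined by the analytic function
  that it represents there.
\<close>

definition H2 :: "complex fps set" where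
  "H2 = {f. summable (\<lambda>n. (cmod (fps_nth f n))\<^sup>2)}"

definition H2_inner :: "complex fps \<Rightarrow> complex fps \<Rightarrow> complex" where
  "H2_inner f g = (\<Sum>n. fps_nth f n * cnj (fps_nth g n))"

definition H2_norm :: "complex fps \<Rightarrow> real" where
  "H2_norm f = sqrt (Re (H2_inner f f))"

definition F2q :: "real \<Rightarrow> complex fps set" where
  "F2q q = {f. summable (\<lambda>n. (cmod (fps_nth f n))\<^sup>2 * (q_fact q n)\<^sup>2)}"

definition F2q_inner :: "real \<Rightarrow> complex fps \<Rightarrow> complex fps \<Rightarrow> complex" where
  "F2q_inner q f g = (\<Sum>n. fps_nth f n * cnj (fps_nth g n) * of_real ((q_fact q n)\<^sup>2))"

definition F2q_norm :: "real \<Rightarrow> complex fps \<Rightarrow> real" where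
  "F2q_norm q f = sqrt (Re (F2q_inner q f f))"

definition T_q :: "real \<Rightarrow> complex fps \<Rightarrow> complex fps" where
  "T_q q f = Abs_fps (\<lambda>n. fps_nth f n / of_real (q_fact q n))"

text \<open>The series defining the inner products converge absolutely on the respective spaces.\<close>

lemma H2_inner_summable:
  assumes "f \<in> H2" "g \<in> H2"
  shows "summable (\<lambda>n. norm (fps_nth f n * cnj (fps_nth g n)))"
proof (rule summable_comparison_test')
  show "summable (\<lambda>n. (cmod (fps_nth f n))\<^sup>2 + (cmod (fps_nth g n))\<^sup>2)"
    using assms by (auto simp: H2_def intro: summable_add)
  fix n
  have "2 * cmod (fps_nth f n) * cmod (fps_nth g n) \<le> (cmod (fps_nth f n))\<^sup>2 + (cmod (fps_nth g n))\<^sup>2"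
    by (rule sum_squares_bound)
  moreover have "0 \<le> cmod (fps_nth f n) * cmod (fps_nth g n)" by simp
  ultimately show "norm (norm (fps_nth f n * cnj (fps_nth g n)))
      \<le> (cmod (fps_nth f n))\<^sup>2 + (cmod (fps_nth g n))\<^sup>2"
    unfolding norm_mult complex_mod_cnj abs_norm_cancel real_norm_def abs_mult by linarith
qed

lemma F2q_inner_summable:
  assumes "f \<in> F2q q" "g \<in> F2q q"
  shows "summable (\<lambda>n. norm (fps_nth f n * cnj (fps_nth g n) * of_real ((q_fact q n)\<^sup>2)))"
proof -
  have "Abs_fps (\<lambda>n. fps_nth h n * of_real (q_fact q n)) \<in> H2" if "h \<in> F2q q" for h
    using that by (simp add: H2_def F2q_def norm_mult power_mult_distrib)
  from H2_inner_summable[OF this[OF assms(1)] this[OF assms(2)]]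
  show ?thesis by (simp add: norm_mult power2_eq_square mult_ac)
qed

lemma q_int_ge_1: "0 \<le> q \<Longrightarrow> 0 < n \<Longrightarrow> 1 \<le> q_int q n"
  by (cases n) (auto simp: q_int_def sum.lessThan_Suc_shift simp del: sum.lessThan_Suc intro!: sum_nonneg)

lemma q_fact_ge_1: "0 \<le> q \<Longrightarrow> 1 \<le> q_fact q n"
  unfolding q_fact_def by (rule prod_ge_1) (auto intro: q_int_ge_1)

lemma F2q_subset_H2:
  assumes "0 \<le> q"
  shows "F2q q \<subseteq> H2"
proof
  fix f assume f: "f \<in> F2q q"
  have "(cmod (fps_nth f n))\<^sup>2 * 1 \<le> (cmod (fps_nth f n))\<^sup>2 * (q_fact q n)\<^sup>2" for n
    using q_fact_ge_1[OF assms, of n] by (intro mult_left_mono) (auto simp: one_le_power)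
  then have le: "norm ((cmod (fps_nth f n))\<^sup>2) \<le> (cmod (fps_nth f n))\<^sup>2 * (q_fact q n)\<^sup>2" for n
    by simp
  have "summable (\<lambda>n. (cmod (fps_nth f n))\<^sup>2 * (q_fact q n)\<^sup>2)"
    using f by (simp add: F2q_def)
  then have "summable (\<lambda>n. (cmod (fps_nth f n))\<^sup>2)"
    by (rule summable_comparison_test') (rule le)
  then show "f \<in> H2" by (simp add: H2_def)
qed

lemma conv_radius_H2:
  assumes "f \<in> H2"
  shows "fps_conv_radius f \<ge> 1"
proof -
  have "(\<lambda>n. (cmod (fps_nth f n))\<^sup>2) \<longlonglongrightarrow> 0"
    using assms by (auto simp: H2_def dest: summable_LIMSEQ_zero)
  then have "Bseq (\<lambda>n. (cmod (fps_nth f n))\<^sup>2)"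
    by (meson convergentI convergent_imp_Bseq)
  then obtain K where K: "0 < K" "\<And>n. norm ((cmod (fps_nth f n))\<^sup>2) \<le> K"
    by (auto simp: Bseq_def)
  have bound: "cmod (fps_nth f n) \<le> 1 + K" for n
  proof (rule power2_le_imp_le)
    have "K \<le> (1 + K)\<^sup>2" using K(1) by (simp add: power2_eq_square algebra_simps)
    with K(2)[of n] show "(cmod (fps_nth f n))\<^sup>2 \<le> (1 + K)\<^sup>2" by simp
  qed (use K(1) in simp)
  show ?thesis unfolding fps_conv_radius_def
  proof (rule conv_radius_geI_ex)
    fix r :: real assume r: "0 < r" "ereal r < 1"
    then have r1: "r < 1" by simp
    have "summable (\<lambda>n. fps_nth f n * of_real r ^ n)"
    proof (rule summable_comparison_test')
      show "summable (\<lambda>n. (1 + K) * r ^ n)"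
        using r r1 by (intro summable_mult summable_geometric) auto
      show "norm (fps_nth f n * of_real r ^ n) \<le> (1 + K) * r ^ n" for n
        using bound[of n] r by (auto simp: norm_mult norm_power intro: mult_right_mono)
    qed
    then show "\<exists>z::complex. norm z = r \<and> summable (\<lambda>n. fps_nth f n * z ^ n)"
      using r by (intro exI[of _ "of_real r"]) auto
  qed
qed

lemma conv_radius_F2q:
  assumes "0 \<le> q" "f \<in> F2q q"
  shows "fps_conv_radius f \<ge> 1"
  using assms F2q_subset_H2 conv_radius_H2 by blast

lemma H2_norm_sq:
  assumes "f \<in> H2"
  shows "(\<lambda>n. (cmod (fps_nth f n))\<^sup>2) sums (H2_norm f)\<^sup>2"
proof -
  have s: "summable (\<lambda>n. (cmod (fps_nth f n))\<^sup>2)" using assms by (simp add: H2_def)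
  have "H2_inner f f = of_real (\<Sum>n. (cmod (fps_nth f n))\<^sup>2)"
    unfolding H2_inner_def using suminf_of_real[OF s, where ?'a = complex]
    by (simp add: complex_norm_square[symmetric])
  then have "(H2_norm f)\<^sup>2 = (\<Sum>n. (cmod (fps_nth f n))\<^sup>2)"
    by (simp add: H2_norm_def suminf_nonneg[OF s])
  then show ?thesis using s by (simp add: summable_sums)
qed

lemma F2q_norm_sq:
  assumes "f \<in> F2q q"
  shows "(\<lambda>n. (cmod (fps_nth f n))\<^sup>2 * (q_fact q n)\<^sup>2) sums (F2q_norm q f)\<^sup>2"
proof -
  let ?g = "Abs_fps (\<lambda>n. fps_nth f n * of_real (q_fact q n))"
  have g: "?g \<in> H2"
    using assms by (simp add: H2_def F2q_def norm_mult power_mult_distrib)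
  have "H2_norm ?g = F2q_norm q f"
    by (simp add: H2_norm_def F2q_norm_def H2_inner_def F2q_inner_def power2_eq_square mult_ac)
  with H2_norm_sq[OF g] show ?thesis by (simp add: norm_mult power_mult_distrib)
qed

lemma F2q_norm_nonneg:
  assumes "f \<in> F2q q"
  shows "0 \<le> F2q_norm q f"
proof -
  have "0 \<le> (\<Sum>n. Re (fps_nth f n * cnj (fps_nth f n) * of_real ((q_fact q n)\<^sup>2)))"
    using summable_Re[OF summable_norm_cancel[OF F2q_inner_summable[OF assms assms]]]
    by (rule suminf_nonneg) (simp add: complex_mult_cnj flip: of_real_power)
  also have "\<dots> = Re (F2q_inner q f f)"
    unfolding F2q_inner_def
    by (rule Re_suminf[OF summable_norm_cancel[OF F2q_inner_summable[OF assms assms]], symmetric])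
  finally show ?thesis by (simp add: F2q_norm_def)
qed

text \<open>
  A linear map bounded on \<open>H2\<close> is determined by its values on the monomials, so \<^const>\<open>T_q\<close> is the
  only such map with $z^n \mapsto z^n/[n]_q!$.
\<close>

lemma T_q_unique:
  assumes q: "0 \<le> q"
    and maps: "\<And>f. f \<in> H2 \<Longrightarrow> S f \<in> F2q q"
    and add: "\<And>f g. f \<in> H2 \<Longrightarrow> g \<in> H2 \<Longrightarrow> S (f + g) = S f + S g"
    and scale: "\<And>c f. f \<in> H2 \<Longrightarrow> S (fps_const c * f) = fps_const c * S f"
    and bounded: "\<And>f. f \<in> H2 \<Longrightarrow> F2q_norm q (S f) \<le> C * H2_norm f"
    and monom: "\<And>n. S (fps_X ^ n) = fps_const (1 / of_real (q_fact q n)) * fps_X ^ n"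
    and f: "f \<in> H2"
  shows "S f = T_q q f"
proof (rule fps_ext)
  fix m
  define a where "a n = (cmod (fps_nth f n))\<^sup>2" for n
  have sum_a: "summable a" using f by (simp add: H2_def a_def[abs_def])
  define P where "P N = Abs_fps (\<lambda>n. if n < N then fps_nth f n else 0)" for N
  define R where "R N = Abs_fps (\<lambda>n. if n < N then 0 else fps_nth f n)" for N
  have P: "P N \<in> H2" for N
    unfolding H2_def P_def mem_Collect_eq
    by (rule summable_finite[of "{..<N}"]) auto
  have R: "R N \<in> H2" for N
    using sum_a unfolding H2_def R_def mem_Collect_eq
    by (rule summable_comparison_test'[where N = 0]) (auto simp: a_def)
  have monom_H2: "fps_X ^ n \<in> H2" for n
    unfolding H2_def mem_Collect_eq by (rule summable_finite[of "{n}"]) (auto simp: fps_X_power_iff)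
  have cmon_H2: "fps_const c * fps_X ^ n \<in> H2" for c n
    unfolding H2_def mem_Collect_eq by (rule summable_finite[of "{n}"]) (auto simp: fps_X_power_iff)
  have zero_H2: "0 \<in> H2" by (simp add: H2_def)
  have S0: "S 0 = 0" using scale[OF zero_H2, of 0] by simp
  have PSuc: "P (Suc N) = P N + fps_const (fps_nth f N) * fps_X ^ N" for N
    by (rule fps_ext) (auto simp: P_def fps_X_power_iff less_Suc_eq)
  have SP: "S (P N) = T_q q (P N)" for N
  proof (induction N)
    case 0
    have "P 0 = 0" by (rule fps_ext) (simp add: P_def)
    moreover have "T_q q 0 = 0" by (rule fps_ext) (simp add: T_q_def)
    ultimately show ?case using S0 by simp
  next
    case (Suc N)
    have "S (P (Suc N)) = T_q q (P N) + fps_const (fps_nth f N) * S (fps_X ^ N)"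
      by (simp add: PSuc add[OF P cmon_H2] scale[OF monom_H2] Suc)
    also have "\<dots> = T_q q (P (Suc N))"
      unfolding monom PSuc
      by (rule fps_ext) (auto simp: T_q_def fps_X_power_iff add_divide_distrib)
    finally show ?case .
  qed
  have split: "f = P N + R N" for N by (rule fps_ext) (auto simp: P_def R_def)
  have le: "(cmod (fps_nth (S (R N)) m))\<^sup>2 \<le> C\<^sup>2 * (\<Sum>n. a (n + N))" for N
  proof -
    have F: "S (R N) \<in> F2q q" by (rule maps[OF R])
    have "(cmod (fps_nth (S (R N)) m))\<^sup>2 * 1
        \<le> (cmod (fps_nth (S (R N)) m))\<^sup>2 * (q_fact q m)\<^sup>2"
      using q_fact_ge_1[OF q, of m] by (intro mult_left_mono) (auto simp: one_le_power)
    also have "\<dots> = (\<Sum>n\<in>{m}. (cmod (fps_nth (S (R N)) n))\<^sup>2 * (q_fact q n)\<^sup>2)" by simp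
    also have "\<dots> \<le> (F2q_norm q (S (R N)))\<^sup>2"
      using F2q_norm_sq[OF F] sum_le_suminf[of "\<lambda>n. (cmod (fps_nth (S (R N)) n))\<^sup>2 * (q_fact q n)\<^sup>2" "{m}"]
      by (auto simp: sums_iff)
    also have "\<dots> \<le> (C * H2_norm (R N))\<^sup>2"
      by (rule power_mono[OF bounded[OF R] F2q_norm_nonneg[OF F]])
    also have "\<dots> = C\<^sup>2 * (\<Sum>n. (cmod (fps_nth (R N) n))\<^sup>2)"
      using H2_norm_sq[OF R[of N]] by (simp add: power_mult_distrib sums_iff)
    also have "(\<Sum>n. (cmod (fps_nth (R N) n))\<^sup>2) = (\<Sum>n. a (n + N))"
      using R[of N] suminf_split_initial_segment[of "\<lambda>n. (cmod (fps_nth (R N) n))\<^sup>2" N]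
      by (simp add: H2_def) (simp add: R_def a_def)
    finally show ?thesis by simp
  qed
  have tail: "(\<lambda>N. C\<^sup>2 * (\<Sum>n. a (n + N))) \<longlonglongrightarrow> C\<^sup>2 * 0"
    by (intro tendsto_mult tendsto_const suminf_exist_split2 sum_a)
  have "(\<lambda>N. (cmod (fps_nth (S (R N)) m))\<^sup>2) \<longlonglongrightarrow> 0"
    by (rule tendsto_sandwich[OF _ _ tendsto_const tail[unfolded mult_zero_right]]) (use le in auto)
  moreover have "\<forall>\<^sub>F N in sequentially.
      (cmod (fps_nth (S (R N)) m))\<^sup>2 = (cmod (fps_nth (S f) m - fps_nth (T_q q f) m))\<^sup>2"
    using eventually_gt_at_top[of m]
  proof eventually_elim
    case (elim N)
    have "S f = T_q q (P N) + S (R N)"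
      by (subst split[of N]) (simp add: add[OF P R] SP)
    with elim show ?case by (simp add: T_q_def P_def)
  qed
  ultimately have "(\<lambda>N::nat. (cmod (fps_nth (S f) m - fps_nth (T_q q f) m))\<^sup>2) \<longlonglongrightarrow> 0"
    by (rule Lim_transform_eventually)
  from LIMSEQ_unique[OF this tendsto_const] show "fps_nth (S f) m = fps_nth (T_q q f) m"
    by simp
qed

end

theory Submission imports Defs begin

text \<open>\<open>T_q\<close> is diagonal in the monomials, and the weight of \<open>F2q\<close> is
  the square of the factor by which \<open>T_q\<close> divides. The two cancel term by term, so
  inner products agree (\<open>F2q_inner_T_q\<close>) and so do the membership conditions
  (\<open>T_q_in_F2q_iff\<close>). As the factors are nonzero, \<open>T_q\<close> is invertible on
  all formal power series, hence onto \<open>F2q\<close>.\<close>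

lemma q_fact_neq_0: "0 \<le> q \<Longrightarrow> q_fact q n \<noteq> 0"
  using q_fact_ge_1[of q n] by linarith

lemma T_q_nth: "fps_nth (T_q q f) n = fps_nth f n / of_real (q_fact q n)"
  by (simp add: T_q_def)

lemma T_q_add: "T_q q (f + g) = T_q q f + T_q q g"
  by (rule fps_ext) (simp add: T_q_nth add_divide_distrib)

lemma T_q_scale: "T_q q (fps_const c * f) = fps_const c * T_q q f"
  by (rule fps_ext) (simp add: T_q_nth)

lemma T_q_X_power: "T_q q (fps_X ^ n) = fps_const (1 / of_real (q_fact q n)) * fps_X ^ n"
  by (rule fps_ext) (simp add: T_q_nth fps_X_power_iff)

text \<open>After cancellation both sides ask for summability of the same series. The forward
  direction is what places preimages of elements of \<open>F2q\<close> in \<open>H2\<close>.\<close>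

lemma T_q_in_F2q_iff:
  assumes "0 \<le> q"
  shows "T_q q f \<in> F2q q \<longleftrightarrow> f \<in> H2"
  using q_fact_neq_0[OF assms]
  by (simp add: F2q_def H2_def T_q_nth norm_divide power_divide)

lemma surj_T_q:
  assumes "0 \<le> q"
  shows "surj (T_q q)"
proof (rule surjI)
  \<comment> \<open>The inverse multiplies each coefficient back by its q-factorial.\<close>
  show "T_q q (Abs_fps (\<lambda>n. fps_nth g n * of_real (q_fact q n))) = g" for g
    using q_fact_neq_0[OF assms] by (intro fps_ext) (simp add: T_q_nth)
qed

lemma T_q_image_H2:
  assumes "0 \<le> q"
  shows "T_q q ` H2 = F2q q"
  using T_q_in_F2q_iff[OF assms] surj_T_q[OF assms] by (auto simp: surj_def image_iff) metis

lemma F2q_inner_T_q: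
  assumes "0 \<le> q"
  shows "F2q_inner q (T_q q f) (T_q q g) = H2_inner f g"
  using q_fact_neq_0[OF assms]
  by (simp add: F2q_inner_def H2_inner_def T_q_nth power2_eq_square)

theorem theorem4p4:
  fixes q :: real
  assumes "q \<in> {0..1}"
  shows
    "(\<forall>f\<in>H2. \<forall>g\<in>H2. T_q q (f + g) = T_q q f + T_q q g) \<and>
     (\<forall>c. \<forall>f\<in>H2. T_q q (fps_const c * f) = fps_const c * T_q q f) \<and>
     (\<forall>n. T_q q (fps_X ^ n) = fps_const (1 / of_real (q_fact q n)) * fps_X ^ n) \<and>
     T_q q ` H2 = F2q q \<and>
     (\<forall>f\<in>H2. F2q_norm q (T_q q f) = H2_norm f) \<and>
     (\<forall>f\<in>H2. \<forall>g\<in>H2. F2q_inner q (T_q q f) (T_q q g) = H2_inner f g)"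
proof -
  have "0 \<le> q" using assms by simp
  then show ?thesis
    \<comment> \<open>Both norms unfold to inner products, so \<open>F2q_inner_T_q\<close> also
      gives the isometry.\<close>
    by (simp add: T_q_add T_q_scale T_q_X_power T_q_image_H2 F2q_inner_T_q F2q_norm_def H2_norm_def)
qed

end
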